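(* The extension $$1\to\mathcal{PZ}_n\to\mathcal Z_n\to S_n\to 1$$ induced by the usual map $B_n\to S_n$ is not split.
   Context: $B_n$ is the braid group on $n$ strands, $S_n$ is the symmetric group, and $PB_n$ is the pure braid group, the kernel of the usual map $B_n\to S_n$. The level $4$ braid group $B_n[4]$ is the kernel of the composition $B_n\to GL_n(\mathbb{Z}[t,t^{-1}])\to GL_n(\mathbb{Z})\to GL_n(\mathbb{Z}/4)$ (unreduced Burau representation, evaluation at $t=-1$, reduction mod $4$). It is known that $B_n[4]$ equals the subgroup of $PB_n$ generated by all squares of elements of $PB_n$. Put $\mathcal Z_n=B_n/B_n[4]$ and let $\mathcal{PZ}_n$ be the image of $PB_n$ in $\mathcal Z_n$. *)

theory Defs
  imports
    "HOL-Algebra.Sym_Groups"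
    "HOL-Algebra.Exact_Sequence"
    "HOL-Library.Poly_Mapping"
    "HOL-Library.Numeral_Type"
    "Jordan_Normal_Form.Matrix"
begin

section \<open>The braid group\<close>

text \<open>
  \<open>B\<^sub>n\<close> is given by Artin's presentation with generators \<open>\<sigma>\<^sub>1, \<dots>, \<sigma>\<^sub>n\<^sub>-\<^sub>1\<close>.
  A letter \<open>(i, True)\<close> stands for \<open>\<sigma>\<^sub>i\<close> and \<open>(i, False)\<close> for its inverse; the elements of
  the group are the classes of words under the congruence generated by free cancellation and
  the Artin relations.
\<close>

type_synonym braid_word = "(nat \<times> bool) list"

definition braid_words :: "nat \<Rightarrow> braid_word set" where
  "braid_words n = lists ({1..<n} \<times> UNIV)"

inductive braid_eq :: "nat \<Rightarrow> braid_word \<Rightarrow> braid_word \<Rightarrow> bool" for n where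
  refl: "w \<in> braid_words n \<Longrightarrow> braid_eq n w w"
| sym: "braid_eq n u v \<Longrightarrow> braid_eq n v u"
| trans: "braid_eq n u v \<Longrightarrow> braid_eq n v w \<Longrightarrow> braid_eq n u w"
| append: "braid_eq n u u' \<Longrightarrow> braid_eq n v v' \<Longrightarrow> braid_eq n (u @ v) (u' @ v')"
| cancel: "i \<in> {1..<n} \<Longrightarrow> braid_eq n [(i, b), (i, \<not> b)] []"
| far: "i \<in> {1..<n} \<Longrightarrow> j \<in> {1..<n} \<Longrightarrow> i + 2 \<le> j \<Longrightarrow>
    braid_eq n [(i, True), (j, True)] [(j, True), (i, True)]"
| braid: "i \<in> {1..<n} \<Longrightarrow> i + 1 \<in> {1..<n} \<Longrightarrow>
    braid_eq n [(i, True), (i + 1, True), (i, True)] [(i + 1, True), (i, True), (i + 1, True)]"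

definition braid_class :: "nat \<Rightarrow> braid_word \<Rightarrow> braid_word set" where
  "braid_class n w = {v. braid_eq n w v}"

definition braid_group :: "nat \<Rightarrow> braid_word set monoid" where
  "braid_group n =
    \<lparr>carrier = braid_words n // {(u, v). braid_eq n u v},
     mult = (\<lambda>X Y. \<Union>u\<in>X. \<Union>v\<in>Y. braid_class n (u @ v)),
     one = braid_class n []\<rparr>"

lemma braid_words_append [simp]:
  "u @ v \<in> braid_words n \<longleftrightarrow> u \<in> braid_words n \<and> v \<in> braid_words n"
  by (auto simp: braid_words_def)

lemma braid_words_Nil [simp]: "[] \<in> braid_words n"
  by (simp add: braid_words_def)

lemma braid_words_Cons [simp]:
  "(i, b) # w \<in> braid_words n \<longleftrightarrow> i \<in> {1..<n} \<and> w \<in> braid_words n"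
  by (auto simp: braid_words_def)

lemma braid_eq_words: "braid_eq n u v \<Longrightarrow> u \<in> braid_words n \<and> v \<in> braid_words n"
  by (induction rule: braid_eq.induct) auto

lemma braid_eq_equiv: "equiv (braid_words n) {(u, v). braid_eq n u v}"
proof (rule equivI)
  show "refl_on (braid_words n) {(u, v). braid_eq n u v}"
    by (auto simp: refl_on_def intro: braid_eq.refl dest: braid_eq_words)
  show "{(u, v). braid_eq n u v} \<subseteq> braid_words n \<times> braid_words n"
    by (auto dest: braid_eq_words)
  show "sym {(u, v). braid_eq n u v}"
    by (rule symI) (simp add: braid_eq.sym)
  show "trans {(u, v). braid_eq n u v}"
    by (rule transI) (simp, rule braid_eq.trans)
qed

lemma braid_class_eq_iff:
  assumes "u \<in> braid_words n"
  shows "braid_class n u = braid_class n v \<longleftrightarrow> braid_eq n u v"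
proof
  assume "braid_class n u = braid_class n v"
  then show "braid_eq n u v"
    using braid_eq.refl[OF assms] by (metis braid_class_def mem_Collect_eq braid_eq.sym)
next
  assume "braid_eq n u v"
  then have "braid_eq n u w \<longleftrightarrow> braid_eq n v w" for w
    by (metis braid_eq.sym braid_eq.trans)
  then show "braid_class n u = braid_class n v"
    by (simp add: braid_class_def)
qed

lemma braid_group_carrier: "carrier (braid_group n) = braid_class n ` braid_words n"
  by (auto simp: braid_group_def quotient_def braid_class_def)

lemma braid_group_mult:
  assumes "u \<in> braid_words n" "v \<in> braid_words n"
  shows "braid_class n u \<otimes>\<^bsub>braid_group n\<^esub> braid_class n v = braid_class n (u @ v)"
proof -
  have "braid_class n (u' @ v') = braid_class n (u @ v)"
    if "braid_eq n u u'" "braid_eq n v v'" for u' v'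
    using that assms by (metis braid_class_eq_iff braid_eq.append braid_words_append)
  moreover have "braid_eq n u u" "braid_eq n v v"
    using assms by (auto intro: braid_eq.refl)
  ultimately have "(\<Union>u'\<in>braid_class n u. \<Union>v'\<in>braid_class n v. braid_class n (u' @ v'))
      = braid_class n (u @ v)"
    unfolding braid_class_def[of n u] braid_class_def[of n v] by blast
  then show ?thesis by (simp add: braid_group_def)
qed

lemma braid_group_one: "\<one>\<^bsub>braid_group n\<^esub> = braid_class n []"
  by (simp add: braid_group_def)

lemma braid_word_inverse:
  "w \<in> braid_words n \<Longrightarrow> \<exists>v\<in>braid_words n. braid_eq n (v @ w) []"
proof (induction w)
  case Nil
  then show ?case by (auto intro!: bexI[of _ "[]"] braid_eq.refl)
next
  case (Cons a w)
  obtain i b where a: "a = (i, b)" by force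
  with Cons obtain v where v: "v \<in> braid_words n" "braid_eq n (v @ w) []" by auto
  have i: "i \<in> {1..<n}" and w: "w \<in> braid_words n" using Cons.prems a by auto
  have "braid_eq n ([(i, \<not> b), (i, b)] @ w) ([] @ w)"
    using braid_eq.append[OF braid_eq.cancel[OF i, of "\<not> b"] braid_eq.refl[OF w]] by simp
  then have "braid_eq n (v @ [(i, \<not> b), (i, b)] @ w) (v @ w)"
    using braid_eq.append[OF braid_eq.refl[OF v(1)]] by fastforce
  then have "braid_eq n ((v @ [(i, \<not> b)]) @ a # w) []"
    using braid_eq.trans[OF _ v(2)] a by simp
  moreover have "v @ [(i, \<not> b)] \<in> braid_words n" using v(1) i by simp
  ultimately show ?case by blast
qed

lemma braid_group_group: "group (braid_group n)"
proof (rule groupI)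
  show "\<exists>Y\<in>carrier (braid_group n). Y \<otimes>\<^bsub>braid_group n\<^esub> X = \<one>\<^bsub>braid_group n\<^esub>"
    if X: "X \<in> carrier (braid_group n)" for X
  proof -
    obtain w where w: "w \<in> braid_words n" "X = braid_class n w"
      using X by (auto simp: braid_group_carrier)
    obtain v where v: "v \<in> braid_words n" "braid_eq n (v @ w) []"
      using braid_word_inverse[OF w(1)] by blast
    then have "braid_class n (v @ w) = braid_class n []"
      using w braid_class_eq_iff[of "v @ w" n "[]"] by simp
    then show ?thesis
      using v w by (auto simp: braid_group_carrier braid_group_one braid_group_mult)
  qed
qed (auto simp: braid_group_carrier braid_group_mult braid_group_one)

text \<open>
  The homomorphism \<open>B\<^sub>n \<rightarrow> G\<close> sending \<open>\<sigma>\<^sub>i\<close> to \<open>f i\<close>; it is well defined when the \<open>f i\<close>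
  satisfy the Artin relations, see \<open>braid_lift_hom\<close>.
\<close>

definition braid_word_eval :: "('g, 'x) monoid_scheme \<Rightarrow> (nat \<Rightarrow> 'g) \<Rightarrow> braid_word \<Rightarrow> 'g" where
  "braid_word_eval G f w =
    foldr (\<lambda>(i, b) g. (if b then f i else inv\<^bsub>G\<^esub> f i) \<otimes>\<^bsub>G\<^esub> g) w \<one>\<^bsub>G\<^esub>"

definition braid_lift :: "('g, 'x) monoid_scheme \<Rightarrow> (nat \<Rightarrow> 'g) \<Rightarrow> braid_word set \<Rightarrow> 'g" where
  "braid_lift G f X = the_elem (braid_word_eval G f ` X)"

locale artin_rep = group G for G (structure) +
  fixes n :: nat and f :: "nat \<Rightarrow> 'a"
  assumes gen_closed: "i \<in> {1..<n} \<Longrightarrow> f i \<in> carrier G"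
    and gen_far: "\<lbrakk>i \<in> {1..<n}; j \<in> {1..<n}; i + 2 \<le> j\<rbrakk> \<Longrightarrow> f i \<otimes> f j = f j \<otimes> f i"
    and gen_braid: "\<lbrakk>i \<in> {1..<n}; i + 1 \<in> {1..<n}\<rbrakk> \<Longrightarrow>
      f i \<otimes> (f (i + 1) \<otimes> f i) = f (i + 1) \<otimes> (f i \<otimes> f (i + 1))"
begin

lemma eval_closed: "w \<in> braid_words n \<Longrightarrow> braid_word_eval G f w \<in> carrier G"
proof (induction w)
  case Nil
  then show ?case by (simp add: braid_word_eval_def)
next
  case (Cons a w)
  obtain i b where "a = (i, b)" by force
  with Cons show ?case using gen_closed[of i] by (auto simp: braid_word_eval_def)
qed

lemma eval_append:
  "\<lbrakk>u \<in> braid_words n; v \<in> braid_words n\<rbrakk> \<Longrightarrow>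
    braid_word_eval G f (u @ v) = braid_word_eval G f u \<otimes> braid_word_eval G f v"
proof (induction u)
  case Nil
  then show ?case using eval_closed[of v] by (simp add: braid_word_eval_def)
next
  case (Cons a u)
  obtain i b where a: "a = (i, b)" by force
  have [simp]: "braid_word_eval G f ((i, b) # w) =
      (if b then f i else inv f i) \<otimes> braid_word_eval G f w" for w
    by (simp add: braid_word_eval_def)
  show ?case
    using Cons a gen_closed[of i] eval_closed[of u] eval_closed[of v] by (simp add: m_assoc)
qed

lemma eval_cong: "braid_eq n u v \<Longrightarrow> braid_word_eval G f u = braid_word_eval G f v"
proof (induction rule: braid_eq.induct)
  case (append u u' v v')
  then show ?case
    using braid_eq_words[OF append(1)] braid_eq_words[OF append(2)] by (simp add: eval_append)
next
  case (cancel i b)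
  then show ?case using gen_closed[of i] by (simp add: braid_word_eval_def)
next
  case (far i j)
  have "braid_word_eval G f [(i, True), (j, True)] = f i \<otimes> f j"
    "braid_word_eval G f [(j, True), (i, True)] = f j \<otimes> f i"
    using gen_closed[OF far(1)] gen_closed[OF far(2)] by (simp_all add: braid_word_eval_def)
  then show ?case by (simp only: gen_far[OF far])
next
  case (braid i)
  have "braid_word_eval G f [(i, True), (i + 1, True), (i, True)] = f i \<otimes> (f (i + 1) \<otimes> f i)"
    "braid_word_eval G f [(i + 1, True), (i, True), (i + 1, True)] =
      f (i + 1) \<otimes> (f i \<otimes> f (i + 1))"
    using gen_closed[OF braid(1)] gen_closed[OF braid(2)] by (simp_all add: braid_word_eval_def)
  then show ?case by (simp only: gen_braid[OF braid])
qed auto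

lemma braid_lift_class:
  assumes "w \<in> braid_words n"
  shows "braid_lift G f (braid_class n w) = braid_word_eval G f w"
proof -
  have "braid_word_eval G f ` braid_class n w = {braid_word_eval G f w}"
    unfolding braid_class_def using braid_eq.refl[OF assms] by (force dest: eval_cong)
  then show ?thesis by (simp add: braid_lift_def)
qed

lemma braid_lift_gen:
  "i \<in> {1..<n} \<Longrightarrow> braid_lift G f (braid_class n [(i, True)]) = f i"
  using gen_closed[of i] by (subst braid_lift_class) (auto simp: braid_word_eval_def)

lemma braid_lift_hom: "braid_lift G f \<in> hom (braid_group n) G"
  by (rule homI)
    (auto simp: braid_group_carrier braid_group_mult braid_lift_class eval_closed eval_append)

end

section \<open>The map to the symmetric group\<close>

definition braid_perm :: "nat \<Rightarrow> braid_word set \<Rightarrow> nat \<Rightarrow> nat" where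
  "braid_perm n = braid_lift (sym_group n) (\<lambda>i. transpose i (i + 1))"

definition pure_braid_group :: "nat \<Rightarrow> braid_word set set" where
  "pure_braid_group n = kernel (braid_group n) (sym_group n) (braid_perm n)"

lemma artin_rep_perm: "artin_rep (sym_group n) n (\<lambda>i. transpose i (i + 1))"
proof (intro artin_rep.intro sym_group_is_group artin_rep_axioms.intro)
  show "transpose i (i + 1) \<in> carrier (sym_group n)" if "i \<in> {1..<n}" for i
    using that by (simp add: sym_group_carrier permutes_swap_id)
qed (auto simp: sym_group_def fun_eq_iff transpose_def)

lemma braid_perm_hom: "braid_perm n \<in> hom (braid_group n) (sym_group n)"
  unfolding braid_perm_def by (rule artin_rep.braid_lift_hom[OF artin_rep_perm])

section \<open>The Burau representation\<close>

text \<open>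
  The Laurent polynomial ring \<open>\<int>[t, t\<^sup>-\<^sup>1]\<close> is the group ring of \<open>\<int>\<close>: the exponent-indexed
  finitely supported functions with convolution as multiplication.
\<close>

type_synonym laurent = "int \<Rightarrow>\<^sub>0 int"

definition laurent_t :: laurent where
  "laurent_t = Poly_Mapping.single 1 1"

definition laurent_eval_neg1 :: "laurent \<Rightarrow> int" where
  "laurent_eval_neg1 p =
    (\<Sum>k\<in>Poly_Mapping.keys p. Poly_Mapping.lookup p k * (if even k then 1 else - 1))"

definition general_linear :: "'r::comm_ring_1 itself \<Rightarrow> nat \<Rightarrow> 'r mat monoid" where
  "general_linear R n = units_of (ring_mat R n ())"

text \<open>
  The identity matrix with the \<open>2 \<times> 2\<close> block with rows \<open>(a, b)\<close> and \<open>(c, d)\<close> placed on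
  coordinates \<open>i\<close> and \<open>i + 1\<close>, coordinates being counted from \<open>1\<close>, whereas matrix indices
  are counted from \<open>0\<close>.
\<close>

definition block_at :: "nat \<Rightarrow> nat \<Rightarrow> 'r \<Rightarrow> 'r \<Rightarrow> 'r \<Rightarrow> 'r \<Rightarrow> 'r::comm_ring_1 mat" where
  "block_at n i a b c d = mat n n (\<lambda>(r, s).
     if r + 1 = i \<and> s + 1 = i then a
     else if r + 1 = i \<and> s = i then b
     else if r = i \<and> s + 1 = i then c
     else if r = i \<and> s = i then d
     else if r = s then 1 else 0)"

definition burau_gen :: "nat \<Rightarrow> nat \<Rightarrow> laurent mat" where
  "burau_gen n i = block_at n i (1 - laurent_t) laurent_t 1 0"

definition burau :: "nat \<Rightarrow> braid_word set \<Rightarrow> laurent mat" where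
  "burau n = braid_lift (general_linear TYPE(laurent) n) (burau_gen n)"

lemma general_linear_mult: "A \<otimes>\<^bsub>general_linear R n\<^esub> B = A * B"
  by (simp add: general_linear_def units_of_def ring_mat_def)

lemma block_at_mult:
  assumes "i \<in> {1..<n}" "A \<in> carrier_mat n n"
  shows "block_at n i a b c d * A = mat n n (\<lambda>(r, s).
     if r + 1 = i then a * A $$ (i - 1, s) + b * A $$ (i, s)
     else if r = i then c * A $$ (i - 1, s) + d * A $$ (i, s) else A $$ (r, s))"
    (is "?L = ?R")
proof (rule eq_matI)
  fix r s assume "r < dim_row ?R" "s < dim_col ?R"
  then have rs: "r < n" "s < n" by auto
  let ?f = "\<lambda>k. block_at n i a b c d $$ (r, k) * A $$ (k, s)"
  have L: "?L $$ (r, s) = (\<Sum>k<n. ?f k)"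
    using rs assms by (simp add: scalar_prod_def block_at_def lessThan_atLeast0)
  show "?L $$ (r, s) = ?R $$ (r, s)"
  proof (cases "r + 1 = i \<or> r = i")
    case True
    have "(\<Sum>k<n. ?f k) = (\<Sum>k\<in>{i - 1, i}. ?f k)"
      using assms rs True by (intro sum.mono_neutral_right) (auto simp: block_at_def)
    then show ?thesis
      using assms rs True L by (auto simp: block_at_def)
  next
    case False
    have "(\<Sum>k<n. ?f k) = (\<Sum>k\<in>{r}. ?f k)"
      using assms rs False by (intro sum.mono_neutral_right) (auto simp: block_at_def)
    then show ?thesis
      using assms rs False L by (auto simp: block_at_def)
  qed
qed (use assms in \<open>auto simp: block_at_def\<close>)

lemma block_at_closed [simp]: "block_at n i a b c d \<in> carrier_mat n n"
  by (simp add: block_at_def)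

lemma block_at_index:
  "\<lbrakk>r < n; s < n\<rbrakk> \<Longrightarrow> block_at n (Suc p) a b c d $$ (r, s) =
    (if r = p then if s = p then a else if s = Suc p then b else 0
     else if r = Suc p then if s = p then c else if s = Suc p then d else 0
     else if r = s then 1 else 0)"
  by (auto simp: block_at_def)

lemma block_at_braid:
  fixes t :: "'a::comm_ring_1" and n :: nat
  defines S_def: "S \<equiv> \<lambda>i. block_at n i (1 - t) t 1 0"
  assumes p: "Suc (Suc p) < n"
  shows "S (Suc p) * (S (Suc (Suc p)) * S (Suc p)) =
    S (Suc (Suc p)) * (S (Suc p) * S (Suc (Suc p)))"
proof -
  have i: "Suc p \<in> {1..<n}" "Suc (Suc p) \<in> {1..<n}" using p by auto
  have lt: "p < n" "Suc p < n" using p by auto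
  show ?thesis
    unfolding S_def block_at_mult[OF i(1) block_at_closed]
      block_at_mult[OF i(2) block_at_closed] block_at_mult[OF i(1) mat_carrier]
      block_at_mult[OF i(2) mat_carrier]
  proof (rule eq_matI, goal_cases)
    case (1 r s)
    then have rs: "r < n" "s < n" by auto
    consider "r = p" | "r = Suc p" | "r = Suc (Suc p)" | "r \<noteq> p" "r \<noteq> Suc p" "r \<noteq> Suc (Suc p)" by blast
    then show ?case
    proof cases
      case 1
      show ?thesis using rs p lt by (simp add: 1 block_at_index) (simp add: algebra_simps)
    next
      case 2
      show ?thesis using rs p lt by (simp add: 2 block_at_index)
    next
      case 3
      show ?thesis using rs p lt by (simp add: 3 block_at_index)
    next
      case 4
      show ?thesis using rs p lt 4 by (simp add: block_at_index)
    qed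
  qed simp_all
qed
lemma laurent_t_unit: "laurent_t * Poly_Mapping.single (- 1) 1 = 1"
  by (simp add: laurent_t_def mult_single)

lemma burau_gen_closed:
  assumes "i \<in> {1..<n}"
  shows "burau_gen n i \<in> carrier (general_linear TYPE(laurent) n)"
proof -
  define u :: laurent where "u = Poly_Mapping.single (- 1) 1"
  have tu: "laurent_t * u = 1" "u * laurent_t = 1"
    using laurent_t_unit by (auto simp: u_def mult.commute)
  let ?J = "block_at n i 0 1 u (1 - u)"
  obtain p where p: "i = Suc p" using assms by (cases i) auto
  have "burau_gen n i * ?J = 1\<^sub>m n"
    unfolding burau_gen_def block_at_mult[OF assms block_at_closed]
    by (rule eq_matI) (use assms p in \<open>auto simp: block_at_index tu right_diff_distrib\<close>)
  moreover have "?J * burau_gen n i = 1\<^sub>m n"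
    unfolding burau_gen_def block_at_mult[OF assms block_at_closed]
    by (rule eq_matI) (use assms p in \<open>auto simp: block_at_index tu algebra_simps\<close>)
  moreover have "burau_gen n i \<in> carrier_mat n n" by (simp add: burau_gen_def)
  moreover have "?J \<in> carrier_mat n n" by simp
  ultimately show ?thesis
    unfolding general_linear_def units_of_carrier Units_def ring_mat_simps by blast
qed

lemma artin_rep_burau: "artin_rep (general_linear TYPE(laurent) n) n (burau_gen n)"
proof (intro artin_rep.intro artin_rep_axioms.intro burau_gen_closed)
  show "group (general_linear TYPE(laurent) n)"
    unfolding general_linear_def
    by (rule monoid.units_group) (simp add: ring.is_monoid ring_mat)
next
  fix i j assume *: "i \<in> {1..<n}" "j \<in> {1..<n}" "i + 2 \<le> j"
  then have "burau_gen n i * burau_gen n j = burau_gen n j * burau_gen n i"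
    unfolding burau_gen_def block_at_mult[OF *(1) block_at_closed]
      block_at_mult[OF *(2) block_at_closed]
  proof (intro eq_matI, goal_cases)
    case (1 r s)
    then consider "r + 1 = i" | "r = i" | "r + 1 = j" | "r = j"
      | "r + 1 \<noteq> i" "r \<noteq> i" "r + 1 \<noteq> j" "r \<noteq> j" by blast
    moreover obtain p q where "i = Suc p" "j = Suc q"
      using * by (cases i; cases j) auto
    ultimately show ?case
      using * 1 by cases (simp_all add: block_at_def)
  qed simp_all
  then show "burau_gen n i \<otimes>\<^bsub>general_linear TYPE(laurent) n\<^esub> burau_gen n j =
      burau_gen n j \<otimes>\<^bsub>general_linear TYPE(laurent) n\<^esub> burau_gen n i"
    by (simp add: general_linear_def units_of_def ring_mat_def)
next
  fix i assume *: "i \<in> {1..<n}" "i + 1 \<in> {1..<n}"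
  then have "burau_gen n i * (burau_gen n (i + 1) * burau_gen n i) =
      burau_gen n (i + 1) * (burau_gen n i * burau_gen n (i + 1))"
    by (cases i) (auto simp: burau_gen_def intro: block_at_braid)
  then show "burau_gen n i \<otimes>\<^bsub>general_linear TYPE(laurent) n\<^esub>
        (burau_gen n (i + 1) \<otimes>\<^bsub>general_linear TYPE(laurent) n\<^esub> burau_gen n i) =
      burau_gen n (i + 1) \<otimes>\<^bsub>general_linear TYPE(laurent) n\<^esub>
        (burau_gen n i \<otimes>\<^bsub>general_linear TYPE(laurent) n\<^esub> burau_gen n (i + 1))"
    by (simp only: general_linear_mult)
qed

lemma burau_hom: "burau n \<in> hom (braid_group n) (general_linear TYPE(laurent) n)"
  unfolding burau_def by (rule artin_rep.braid_lift_hom[OF artin_rep_burau])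

section \<open>The level four braid group and the extension\<close>

text \<open>The ring \<open>\<int>/4\<close> is the numeral type \<^typ>\<open>4\<close>, with reduction map \<^const>\<open>of_int\<close>.\<close>

definition burau_mod4 :: "nat \<Rightarrow> braid_word set \<Rightarrow> 4 mat" where
  "burau_mod4 n = map_mat of_int \<circ> map_mat laurent_eval_neg1 \<circ> burau n"

definition level4_braid_group :: "nat \<Rightarrow> braid_word set set" where
  "level4_braid_group n = kernel (braid_group n) (general_linear TYPE(4) n) (burau_mod4 n)"

definition Z_group :: "nat \<Rightarrow> braid_word set set monoid" where
  "Z_group n = braid_group n Mod level4_braid_group n"

definition PZ_group :: "nat \<Rightarrow> braid_word set set monoid" where
  "PZ_group n = (Z_group n)
    \<lparr>carrier := (\<lambda>x. level4_braid_group n #>\<^bsub>braid_group n\<^esub> x) ` pure_braid_group n\<rparr>"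

definition Z_perm :: "nat \<Rightarrow> braid_word set set \<Rightarrow> nat \<Rightarrow> nat" where
  "Z_perm n X = the_elem (braid_perm n ` X)"

text \<open>
  Short exact sequences \<open>1 \<rightarrow> K \<rightarrow> G \<rightarrow> Q \<rightarrow> 1\<close>. The library's \<^const>\<open>short_exact_sequence\<close>
  requires the three groups to have the same element type.
\<close>

definition group_extension ::
  "('k, 'x) monoid_scheme \<Rightarrow> ('g, 'y) monoid_scheme \<Rightarrow> ('q, 'z) monoid_scheme \<Rightarrow>
    ('k \<Rightarrow> 'g) \<Rightarrow> ('g \<Rightarrow> 'q) \<Rightarrow> bool" where
  "group_extension K G Q \<iota> \<pi> \<longleftrightarrow> group K \<and> group G \<and> group Q \<and>
    \<iota> \<in> mon K G \<and> \<pi> \<in> epi G Q \<and> kernel G Q \<pi> = \<iota> ` carrier K"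

definition extension_splits ::
  "('g, 'y) monoid_scheme \<Rightarrow> ('q, 'z) monoid_scheme \<Rightarrow> ('g \<Rightarrow> 'q) \<Rightarrow> bool" where
  "extension_splits G Q \<pi> \<longleftrightarrow> (\<exists>s\<in>hom Q G. \<forall>q\<in>carrier Q. \<pi> (s q) = q)"

end

theory Submission
  imports Defs
begin

text \<open>
  Modulo \<open>2\<close> the Burau matrix at \<open>t = - 1\<close> is the permutation matrix, so modulo \<open>4\<close> a braid with
  permutation \<open>\<pi>\<close> has matrix \<open>A = P\<^sub>\<pi> (1 + 2 M)\<close> with \<open>M\<close> defined modulo \<open>2\<close>. The off-diagonal entries
  of \<open>M + M\<^sup>T\<close> form a cocycle that records the inversions of \<open>\<pi>\<close>; it suffices to see this for one
  more crossing. If \<open>\<pi>\<close> is the transposition of \<open>1\<close> and \<open>2\<close>, the entry of \<open>A\<^sup>2\<close> at \<open>(1, 2)\<close> is twice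
  \<open>M\<^sub>1\<^sub>2 + M\<^sub>2\<^sub>1\<close>, which is odd. Hence no lift of this transposition is an involution.
\<close>

section \<open>The Burau representation modulo four\<close>

text \<open>Coefficients outside the support vanish. Cancellation may shrink the support of a sum,
  so additivity needs a common index set.\<close>

lemma laurent_eval_neg1_superset:
  assumes "finite K" "Poly_Mapping.keys p \<subseteq> K"
  shows "laurent_eval_neg1 p = (\<Sum>k\<in>K. Poly_Mapping.lookup p k * (if even k then 1 else - 1))"
  unfolding laurent_eval_neg1_def using assms
  by (intro sum.mono_neutral_left) (auto simp: in_keys_iff)

lemma laurent_eval_neg1_single:
  "laurent_eval_neg1 (Poly_Mapping.single k c) = c * (if even k then 1 else - 1)"
  by (subst laurent_eval_neg1_superset[of "{k}"]) auto

lemma laurent_eval_neg1_add: "laurent_eval_neg1 (p + q) = laurent_eval_neg1 p + laurent_eval_neg1 q"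
proof -
  let ?K = "Poly_Mapping.keys p \<union> Poly_Mapping.keys q"
  have "Poly_Mapping.keys (p + q) \<subseteq> ?K" by (rule Poly_Mapping.keys_add)
  then show ?thesis
    by (simp add: laurent_eval_neg1_superset[of ?K] lookup_add distrib_right sum.distrib)
qed

lemma laurent_eval_neg1_sum: "laurent_eval_neg1 (\<Sum>i\<in>I. f i) = (\<Sum>i\<in>I. laurent_eval_neg1 (f i))"
  by (induction I rule: infinite_finite_induct)
    (simp_all add: laurent_eval_neg1_add laurent_eval_neg1_def[of 0])

lemma poly_mapping_eq_sum_single:
  "p = (\<Sum>k\<in>Poly_Mapping.keys p. Poly_Mapping.single k (Poly_Mapping.lookup p k))"
  by (rule poly_mapping_eqI) (auto simp: lookup_sum lookup_single when_def in_keys_iff)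

text \<open>Both factors are expanded into monomials, where the claim says that the sign given by
  the parity of the exponent is multiplicative.\<close>

lemma laurent_eval_neg1_mult: "laurent_eval_neg1 (p * q) = laurent_eval_neg1 p * laurent_eval_neg1 q"
proof -
  let ?p = "Poly_Mapping.lookup p" and ?q = "Poly_Mapping.lookup q"
  have "p * q = (\<Sum>i\<in>Poly_Mapping.keys p. \<Sum>j\<in>Poly_Mapping.keys q.
      Poly_Mapping.single i (?p i) * Poly_Mapping.single j (?q j))"
    by (subst poly_mapping_eq_sum_single[of p], subst poly_mapping_eq_sum_single[of q])
      (rule sum_product)
  then have "laurent_eval_neg1 (p * q) =
      (\<Sum>i\<in>Poly_Mapping.keys p. \<Sum>j\<in>Poly_Mapping.keys q.
        (?p i * (if even i then 1 else - 1)) * (?q j * (if even j then 1 else - 1)))"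
    by (simp add: mult_single laurent_eval_neg1_sum laurent_eval_neg1_single)
      (intro sum.cong, auto)
  then show ?thesis
    by (simp add: laurent_eval_neg1_def sum_product)
qed

lemma laurent_eval_neg1_one: "laurent_eval_neg1 1 = 1"
  using laurent_eval_neg1_single[of 0 1] by simp

text \<open>Evaluation and reduction are merged into one ring homomorphism, so that a single
  entrywise map leads from Laurent matrices to matrices mod 4.\<close>

definition laurent_mod4 :: "laurent \<Rightarrow> 4" where
  "laurent_mod4 p = of_int (laurent_eval_neg1 p)"

lemma laurent_mod4_hom: "comm_ring_hom laurent_mod4"
  by unfold_locales
    (simp_all add: laurent_mod4_def laurent_eval_neg1_add laurent_eval_neg1_mult
      laurent_eval_neg1_one laurent_eval_neg1_def[of 0])

lemma laurent_mod4_t: "laurent_mod4 laurent_t = - 1"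
  by (simp add: laurent_mod4_def laurent_t_def laurent_eval_neg1_single)

section \<open>General linear groups and entrywise ring homomorphisms\<close>

lemma general_linear_group: "group (general_linear TYPE('r::comm_ring_1) n)"
  unfolding general_linear_def
  by (rule monoid.units_group) (simp add: ring.is_monoid ring_mat)

lemma general_linear_one: "\<one>\<^bsub>general_linear R n\<^esub> = 1\<^sub>m n"
  by (simp add: general_linear_def units_of_def ring_mat_def)

lemma general_linear_carrier:
  "A \<in> carrier (general_linear TYPE('r::comm_ring_1) n) \<longleftrightarrow>
    A \<in> carrier_mat n n \<and> (\<exists>B\<in>carrier_mat n n. B * A = 1\<^sub>m n \<and> A * B = (1\<^sub>m n :: 'r mat))"
  by (simp add: general_linear_def units_of_carrier Units_def ring_mat_simps)

text \<open>Applied entrywise, \<open>h\<close> carries a two-sided inverse of a matrix to one of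
  its image, so units go to units.\<close>

lemma map_mat_general_linear_hom:
  fixes h :: "'r::comm_ring_1 \<Rightarrow> 's::comm_ring_1"
  assumes "comm_ring_hom h"
  shows "map_mat h \<in> hom (general_linear TYPE('r) n) (general_linear TYPE('s) n)"
proof -
  interpret comm_ring_hom h by fact
  show ?thesis
  proof (rule homI)
    fix A assume "A \<in> carrier (general_linear TYPE('r) n)"
    then obtain B where "A \<in> carrier_mat n n" "B \<in> carrier_mat n n" "B * A = 1\<^sub>m n" "A * B = 1\<^sub>m n"
      by (auto simp: general_linear_carrier)
    then show "map_mat h A \<in> carrier (general_linear TYPE('s) n)"
      unfolding general_linear_carrier
      by (intro conjI bexI[of _ "map_mat h B"])
        (simp_all add: mat_hom_mult[symmetric] mat_hom_one)
  qed (auto simp: general_linear_carrier general_linear_mult intro: mat_hom_mult)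
qed

lemma burau_mod4_eq: "burau_mod4 n = map_mat laurent_mod4 \<circ> burau n"
  by (auto simp: burau_mod4_def laurent_mod4_def fun_eq_iff)

lemma burau_mod4_hom: "burau_mod4 n \<in> hom (braid_group n) (general_linear TYPE(4) n)"
  unfolding burau_mod4_eq
  by (rule hom_compose[OF burau_hom map_mat_general_linear_hom[OF laurent_mod4_hom]])

lemma burau_mod4_group_hom:
  "group_hom (braid_group n) (general_linear TYPE(4) n) (burau_mod4 n)"
  by (intro group_hom.intro group_hom_axioms.intro braid_group_group general_linear_group
      burau_mod4_hom)

text \<open>The entries are \<open>1 - t\<close>, \<open>t\<close>, \<open>1\<close>,
  \<open>0\<close> at t = -1; mod 2 the block is the swap matrix.\<close>

lemma burau_mod4_gen:
  assumes i: "i \<in> {1..<n}"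
  shows "burau_mod4 n (braid_class n [(i, True)]) = block_at n i 2 (- 1) 1 0"
proof -
  interpret comm_ring_hom laurent_mod4 by (rule laurent_mod4_hom)
  have "burau n (braid_class n [(i, True)]) = burau_gen n i"
    unfolding burau_def by (rule artin_rep.braid_lift_gen[OF artin_rep_burau i])
  then show ?thesis
    by (simp add: burau_mod4_eq burau_gen_def)
      (rule eq_matI, auto simp: block_at_def laurent_mod4_t hom_minus)
qed

lemma braid_class_closed: "w \<in> braid_words n \<Longrightarrow> braid_class n w \<in> carrier (braid_group n)"
  by (auto simp: braid_group_carrier)

lemma braid_class_gen_inverse:
  assumes i: "i \<in> {1..<n}"
  shows "braid_class n [(i, False)] = inv\<^bsub>braid_group n\<^esub> braid_class n [(i, True)]"
proof -
  interpret group "braid_group n" by (rule braid_group_group)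
  have "braid_class n [(i, False)] \<otimes>\<^bsub>braid_group n\<^esub> braid_class n [(i, True)] = \<one>\<^bsub>braid_group n\<^esub>"
    using i braid_eq.cancel[OF i, of False]
    by (simp add: braid_group_mult braid_group_one braid_class_eq_iff)
  then show ?thesis
    using i by (intro inv_equality[symmetric]) (auto simp: braid_class_closed)
qed

text \<open>The block of the generator has determinant 1, so its inverse is its adjugate.\<close>

lemma burau_mod4_gen_inverse:
  assumes i: "i \<in> {1..<n}"
  shows "burau_mod4 n (braid_class n [(i, False)]) = block_at n i 0 1 (- 1) 2"
proof -
  interpret group_hom "braid_group n" "general_linear TYPE(4) n" "burau_mod4 n"
    by (rule burau_mod4_group_hom)
  let ?S = "block_at n i 2 (- 1) 1 0 :: 4 mat" and ?T = "block_at n i 0 1 (- 1) 2 :: 4 mat"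
  obtain p where p: "i = Suc p" using i by (cases i) auto
  have TS: "?T * ?S = 1\<^sub>m n" and ST: "?S * ?T = 1\<^sub>m n"
    unfolding block_at_mult[OF i block_at_closed]
    by (rule eq_matI; use i p in \<open>auto simp: block_at_index\<close>)+
  then have "?S \<in> carrier (general_linear TYPE(4) n)" "?T \<in> carrier (general_linear TYPE(4) n)"
    by (auto simp: general_linear_carrier)
  then have "inv\<^bsub>general_linear TYPE(4) n\<^esub> ?S = ?T"
    using TS by (intro group.inv_equality[OF general_linear_group])
      (auto simp: general_linear_mult general_linear_one)
  then show ?thesis
    using i by (simp add: braid_class_gen_inverse burau_mod4_gen braid_class_closed)
qed

section \<open>The braid group and the symmetric group\<close>

lemma braid_perm_group_hom: "group_hom (braid_group n) (sym_group n) (braid_perm n)"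
  by (intro group_hom.intro group_hom_axioms.intro braid_group_group sym_group_is_group
      braid_perm_hom)

lemma braid_perm_letter:
  assumes i: "i \<in> {1..<n}"
  shows "braid_perm n (braid_class n [(i, b)]) = transpose i (i + 1)"
proof -
  interpret group_hom "braid_group n" "sym_group n" "braid_perm n" by (rule braid_perm_group_hom)
  have T: "braid_perm n (braid_class n [(i, True)]) = transpose i (i + 1)"
    unfolding braid_perm_def by (rule artin_rep.braid_lift_gen[OF artin_rep_perm i])
  have "transpose i (i + 1) \<in> carrier (sym_group n)"
    using i by (simp add: sym_group_carrier permutes_swap_id)
  then show ?thesis
    using i T by (cases b) (simp_all add: braid_class_gen_inverse braid_class_closed)
qed

text \<open>Induction on \<open>b - a\<close>: conjugating the transposition of \<open>a\<close> and
  \<open>b - 1\<close> by that of \<open>b - 1\<close> and \<open>b\<close>, the image of a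
  generator, gives that of \<open>a\<close> and \<open>b\<close>.\<close>

lemma transpose_in_braid_perm_image:
  assumes "1 \<le> a" "a < b" "b \<le> n"
  shows "transpose a b \<in> braid_perm n ` carrier (braid_group n)"
  using assms
proof (induction "b - a" arbitrary: b)
  case 0
  then show ?case by simp
next
  case (Suc d)
  interpret group_hom "braid_group n" "sym_group n" "braid_perm n" by (rule braid_perm_group_hom)
  interpret S: subgroup "braid_perm n ` carrier (braid_group n)" "sym_group n"
    by (rule img_is_subgroup)
  let ?c = "b - 1"
  have "braid_perm n (braid_class n [(?c, True)]) = transpose ?c b"
  proof -
    have "?c \<in> {1..<n}" "b = ?c + 1" using Suc by auto
    then show ?thesis using braid_perm_letter[of ?c n True] by simp
  qed
  then have adj: "transpose ?c b \<in> braid_perm n ` carrier (braid_group n)"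
    using Suc by (intro image_eqI[where x = "braid_class n [(?c, True)]"] braid_class_closed) auto
  show ?case
  proof (cases "a = ?c")
    case True
    then show ?thesis using adj by simp
  next
    case False
    then have "transpose a ?c \<in> braid_perm n ` carrier (braid_group n)"
      using Suc by (intro Suc(1)) auto
    then have "transpose ?c b \<circ> (transpose a ?c \<circ> transpose ?c b)
        \<in> braid_perm n ` carrier (braid_group n)"
      using S.m_closed adj by (simp add: sym_group_mult)
    moreover have "transpose ?c b \<circ> (transpose a ?c \<circ> transpose ?c b) = transpose a b"
      using False Suc by (auto simp: fun_eq_iff transpose_def)
    ultimately show ?thesis by simp
  qed
qed

text \<open>The image is a subgroup containing all transpositions, and these generate the symmetric
  group.\<close>

lemma braid_perm_surj: "braid_perm n ` carrier (braid_group n) = carrier (sym_group n)"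
proof
  interpret group_hom "braid_group n" "sym_group n" "braid_perm n" by (rule braid_perm_group_hom)
  interpret S: subgroup "braid_perm n ` carrier (braid_group n)" "sym_group n"
    by (rule img_is_subgroup)
  show "braid_perm n ` carrier (braid_group n) \<subseteq> carrier (sym_group n)"
    by (rule S.subset)
  show "carrier (sym_group n) \<subseteq> braid_perm n ` carrier (braid_group n)"
  proof
    fix p assume "p \<in> carrier (sym_group n)"
    then have "p permutes {1..n}" by (simp add: sym_group_carrier)
    then show "p \<in> braid_perm n ` carrier (braid_group n)"
      using finite_atLeastAtMost
    proof (induction rule: permutes_induct)
      case id
      show ?case using S.one_closed by (simp only: sym_group_one)
    next
      case (swap a b p)
      have "transpose a b \<in> braid_perm n ` carrier (braid_group n)"
        using swap transpose_in_braid_perm_image[of a b n] transpose_in_braid_perm_image[of b a n]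
        by (cases a b rule: linorder_cases) (auto simp: transpose_commute)
      then show ?case using S.m_closed[OF _ swap.IH] unfolding sym_group_mult by blast
    qed
  qed
qed

section \<open>Inversions in Burau matrices\<close>

text \<open>Allows small identities over Z/4 to be settled by enumeration.\<close>

lemma mod4_cases:
  fixes x :: 4
  obtains "x = 0" | "x = 1" | "x = 2" | "x = 3"
proof (cases x)
  case (of_int z)
  then have "z = 0 \<or> z = 1 \<or> z = 2 \<or> z = 3" by auto
  with of_int(1) that show ?thesis by auto
qed

text \<open>
  In the notation of the introduction the entry \<open>A $$ (\<pi> i - 1, j - 1)\<close> is \<open>\<delta>\<^sub>i\<^sub>j + 2 M\<^sub>i\<^sub>j\<close>: strands are
  counted from \<open>1\<close>, matrix indices from \<open>0\<close>.
\<close>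

definition inversion_compatible :: "nat \<Rightarrow> 4 mat \<Rightarrow> (nat \<Rightarrow> nat) \<Rightarrow> bool" where
  "inversion_compatible n A \<pi> \<longleftrightarrow>
    (\<forall>i\<in>{1..n}. \<forall>j\<in>{1..n}. 2 * A $$ (\<pi> i - 1, j - 1) = (if i = j then 2 else 0)) \<and>
    (\<forall>i\<in>{1..n}. \<forall>j\<in>{1..n}. i < j \<longrightarrow>
      A $$ (\<pi> i - 1, j - 1) + A $$ (\<pi> j - 1, i - 1) = (if \<pi> i > \<pi> j then 2 else 0))"

text \<open>With rows labelled by strands, a letter adds 2 to just two entries. One is diagonal; the
  other belongs to the pair of crossing strands, the only pair whose inversion status flips.\<close>

lemma inversion_compatible_letter:
  assumes i: "i \<in> {1..<n}" and A: "A \<in> carrier_mat n n" and \<pi>: "\<pi> permutes {1..n}"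
    and inv: "inversion_compatible n A \<pi>"
    and S: "S = block_at n i 2 (- 1) 1 0 \<or> S = block_at n i 0 1 (- 1) 2"
  shows "inversion_compatible n (S * A) (transpose i (i + 1) \<circ> \<pi>)"
proof -
  \<comment> \<open>Labelling rows by strands removes the row permutation from the comparison of
    \<open>T\<close> and \<open>T'\<close>.\<close>
  define T where "T j k = A $$ (\<pi> j - 1, k - 1)" for j k
  define \<pi>' where "\<pi>' = transpose i (i + 1) \<circ> \<pi>"
  define T' where "T' j k = (S * A) $$ (\<pi>' j - 1, k - 1)" for j k
  \<comment> \<open>These are the two strands that the new letter crosses.\<close>
  obtain a b where a: "a \<in> {1..n}" "\<pi> a = i" and b: "b \<in> {1..n}" "\<pi> b = i + 1"
  proof -
    have "i \<in> \<pi> ` {1..n}" "i + 1 \<in> \<pi> ` {1..n}"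
      using i permutes_image[OF \<pi>] by auto
    then show ?thesis using that by auto
  qed
  have \<pi>_eq: "\<pi> j = i \<longleftrightarrow> j = a" "\<pi> j = Suc i \<longleftrightarrow> j = b" "\<pi> j = \<pi> k \<longleftrightarrow> j = k" for j k
    using injD[OF permutes_inj[OF \<pi>]] a b by auto
  have range: "\<pi> j \<ge> 1" "\<pi> j \<le> n" if "j \<in> {1..n}" for j
    using permutes_in_image[OF \<pi>, of j] that by auto
  have par: "2 * T j k = (if j = k then 2 else 0)" if "j \<in> {1..n}" "k \<in> {1..n}" for j k
    using inv that unfolding inversion_compatible_def T_def by blast
  have sym: "T j k + T k j = (if \<pi> j > \<pi> k then 2 else 0)"
    if "j \<in> {1..n}" "k \<in> {1..n}" "j < k" for j k
    using inv that unfolding inversion_compatible_def T_def by blast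
  \<comment> \<open>Since 4 = 0, a coefficient -1 becomes 1 plus a doubled entry, and doubled
    entries are known from \<open>par\<close>.\<close>
  have neg: "- x = x + 2 * x" for x :: 4
    by (cases x rule: mod4_cases) auto
  \<comment> \<open>After the swap strand \<open>a\<close> is at position \<open>i + 1\<close> and
    reads the second row of the block; strand \<open>b\<close> reads the first.\<close>
  have row: "(block_at n i \<alpha> \<beta> \<gamma> \<delta> * A) $$ (\<pi>' j - 1, k - 1) =
      (if j = a then \<gamma> * T a k + \<delta> * T b k
       else if j = b then \<alpha> * T a k + \<beta> * T b k else T j k)"
    if "j \<in> {1..n}" "k \<in> {1..n}" for j k \<alpha> \<beta> \<gamma> \<delta>
  proof -
    have prod: "(block_at n i \<alpha> \<beta> \<gamma> \<delta> * A) $$ (r, k - 1) =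
        (if r + 1 = i then \<alpha> * T a k + \<beta> * T b k
         else if r = i then \<gamma> * T a k + \<delta> * T b k else A $$ (r, k - 1))"
      if "r < n" for r
      using that \<open>k \<in> {1..n}\<close> a b by (auto simp: block_at_mult[OF i A] T_def)
    consider "j = a" | "j = b" | "j \<noteq> a" "j \<noteq> b" by blast
    then show ?thesis
    proof cases
      case 1
      have "\<pi>' j = i + 1" by (simp add: \<pi>'_def 1 a)
      then show ?thesis using 1 i prod[of i] by simp
    next
      case 2
      have "a \<noteq> b" "\<pi>' j = i" using a b by (auto simp: \<pi>'_def 2)
      then show ?thesis using 2 i prod[of "i - 1"] by auto
    next
      case 3
      then have "\<pi> j \<noteq> i" "\<pi> j \<noteq> i + 1" using \<pi>_eq[of j] by auto
      then have "\<pi>' j = \<pi> j" "\<pi> j - 1 + 1 \<noteq> i" "\<pi> j - 1 \<noteq> i" "\<pi> j - 1 < n"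
        using range[OF that(1)] i by (auto simp: \<pi>'_def)
      then show ?thesis using 3 prod[of "\<pi> j - 1"] by (simp add: T_def)
    qed
  qed
  \<comment> \<open>For either sign one crossing row is merely carried along, while row
    \<open>c\<close> gains \<open>2 * T a k + 2 * T b k\<close>; \<open>c\<close> is
    \<open>b\<close> for a generator and \<open>a\<close> for an inverse.\<close>
  obtain c where c: "c \<in> {a, b}"
    and T': "\<And>j k. j \<in> {1..n} \<Longrightarrow> k \<in> {1..n} \<Longrightarrow>
      T' j k = T j k + (if j = c \<and> k \<in> {a, b} then 2 else 0)"
    using S
  proof
    assume S: "S = block_at n i 2 (- 1) 1 0"
    have "T' j k = T j k + (if j = b \<and> k \<in> {a, b} then 2 else 0)"
      if "j \<in> {1..n}" "k \<in> {1..n}" for j k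
      using row[OF that] neg[of "T b k"] par[OF a(1) that(2)] par[OF b(1) that(2)] a b
      unfolding T'_def S by auto
    then show ?thesis by (intro that[of b]) auto
  next
    assume S: "S = block_at n i 0 1 (- 1) 2"
    have "T' j k = T j k + (if j = a \<and> k \<in> {a, b} then 2 else 0)"
      if "j \<in> {1..n}" "k \<in> {1..n}" for j k
      using row[OF that] neg[of "T a k"] par[OF a(1) that(2)] par[OF b(1) that(2)] a b
      unfolding T'_def S by auto
    then show ?thesis by (intro that[of a]) auto
  qed
  have "2 * T' j k = (if j = k then 2 else 0)" if "j \<in> {1..n}" "k \<in> {1..n}" for j k
    using T'[OF that] par[OF that] by (auto simp: distrib_left)
  moreover have "T' j k + T' k j = (if \<pi>' j > \<pi>' k then 2 else 0)"
    if "j \<in> {1..n}" "k \<in> {1..n}" "j < k" for j k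
  proof (cases "{j, k} = {a, b}")
    \<comment> \<open>Exactly one of the two entries lies in row \<open>c\<close>, and swapping
      adjacent positions reverses the order of \<open>a\<close> and \<open>b\<close>. As 2 + 2 = 0,
      both sides toggle.\<close>
    case True
    then have "T' j k + T' k j = T j k + T k j + 2"
      using T' that c by (auto simp: doubleton_eq_iff)
    moreover have "\<pi>' j > \<pi>' k \<longleftrightarrow> \<not> \<pi> j > \<pi> k"
      using True a b that by (auto simp: \<pi>'_def doubleton_eq_iff)
    ultimately show ?thesis using sym[OF that] by auto
  next
    \<comment> \<open>No strand lies between positions \<open>i\<close> and \<open>i + 1\<close>, so
      every other pair keeps its order, and neither of its entries changes.\<close>
    case False
    then have "T' j k + T' k j = T j k + T k j"
      using T' that c by auto
    moreover have "\<pi>' j > \<pi>' k \<longleftrightarrow> \<pi> j > \<pi> k"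
      using False \<pi>_eq(1,2)[of j] \<pi>_eq(1,2)[of k] \<pi>_eq(3)[of j k] a b that
      by (auto simp: \<pi>'_def transpose_def)
    ultimately show ?thesis using sym[OF that] by auto
  qed
  ultimately show ?thesis
    unfolding inversion_compatible_def T'_def \<pi>'_def by blast
qed

lemma inversion_compatible_one: "inversion_compatible n (1\<^sub>m n) id"
  by (auto simp: inversion_compatible_def)

text \<open>Induction on a word: a prepended letter multiplies both the matrix and the permutation
  on the left, as in \<open>inversion_compatible_letter\<close>.\<close>

lemma inversion_compatible_braid:
  assumes "x \<in> carrier (braid_group n)"
  shows "inversion_compatible n (burau_mod4 n x) (braid_perm n x)"
proof -
  interpret B: group_hom "braid_group n" "general_linear TYPE(4) n" "burau_mod4 n"
    by (rule burau_mod4_group_hom)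
  interpret P: group_hom "braid_group n" "sym_group n" "braid_perm n" by (rule braid_perm_group_hom)
  have "inversion_compatible n (burau_mod4 n (braid_class n w)) (braid_perm n (braid_class n w))"
    if "w \<in> braid_words n" for w
    using that
  proof (induction w)
    case Nil
    then show ?case
      using B.hom_one P.hom_one inversion_compatible_one
      unfolding braid_group_one general_linear_one sym_group_one by metis
  next
    case (Cons l w)
    obtain i b where l: "l = (i, b)" by force
    have i: "i \<in> {1..<n}" and w: "w \<in> braid_words n" using Cons.prems l by auto
    have eq: "braid_class n ((i, b) # w) = braid_class n [(i, b)] \<otimes>\<^bsub>braid_group n\<^esub> braid_class n w"
      using i w by (simp add: braid_group_mult)
    have cl: "braid_class n [(i, b)] \<in> carrier (braid_group n)" "braid_class n w \<in> carrier (braid_group n)"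
      using i w by (auto intro: braid_class_closed)
    show ?case
      unfolding l eq B.hom_mult[OF cl] P.hom_mult[OF cl] general_linear_mult sym_group_mult
        braid_perm_letter[OF i]
      using Cons.IH[OF w] B.hom_closed[OF cl(2)] P.hom_closed[OF cl(2)]
      by (intro inversion_compatible_letter[OF i]; cases b)
        (auto simp: general_linear_carrier sym_group_carrier burau_mod4_gen[OF i]
          burau_mod4_gen_inverse[OF i])
  qed
  then show ?thesis using assms by (auto simp: braid_group_carrier)
qed

text \<open>The entry at \<open>(\<pi> j - 1, j - 1)\<close> doubles to 2, so it is nonzero and must
  lie on the diagonal of the identity matrix.\<close>

lemma inversion_compatible_one_imp_id:
  assumes "inversion_compatible n (1\<^sub>m n) \<pi>" "\<pi> permutes {1..n}"
  shows "\<pi> = id"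
proof
  fix j
  show "\<pi> j = id j"
  proof (cases "j \<in> {1..n}")
    case True
    then have j: "j \<ge> 1" "j \<le> n" "\<pi> j \<ge> 1" "\<pi> j \<le> n"
      using permutes_in_image[OF assms(2), of j] by auto
    have "2 * (1\<^sub>m n :: 4 mat) $$ (\<pi> j - 1, j - 1) = (if j = j then 2 else 0)"
      using assms(1) True unfolding inversion_compatible_def by blast
    then show ?thesis using j by (auto split: if_splits)
  next
    case False
    then show ?thesis using permutes_not_in[OF assms(2)] by simp
  qed
qed

lemma inversion_compatible_transpose_square:
  assumes n: "n \<ge> 2" and A: "A \<in> carrier_mat n n"
    and inv: "inversion_compatible n A (transpose 1 2)"
  shows "A * A \<noteq> 1\<^sub>m n"
proof
  assume sq: "A * A = 1\<^sub>m n"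
  have par: "2 * A $$ (transpose 1 2 i - 1, j - 1) = (if i = j then 2 else 0)"
    if "i \<in> {1..n}" "j \<in> {1..n}" for i j
    using inv that unfolding inversion_compatible_def by blast
  \<comment> \<open>Strand 1 has row 1 and strand 2 has row 0, so the entries compared for this
    inverted pair sit on the diagonal of \<open>A\<close>.\<close>
  have "A $$ (transpose 1 2 1 - 1, 2 - 1) + A $$ (transpose 1 2 2 - 1, 1 - 1) =
      (if transpose 1 2 1 > transpose 1 2 (2::nat) then 2 else 0)"
    using inv n unfolding inversion_compatible_def
    by (elim conjE) (drule bspec[where x = 1], simp, drule bspec[where x = 2], simp_all)
  then have diag: "A $$ (1, 1) + A $$ (0, 0) = 2" by simp
  \<comment> \<open>This entry, belonging to strand 2 and column 2, is odd; multiplied by the 2 from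
    \<open>diag\<close> it gives 2, not 0.\<close>
  have odd: "2 * A $$ (0, 1) = 2" using par[of 2 2] n by simp
  \<comment> \<open>A product of two even elements is 0 mod 4, so only \<open>k = 0\<close> and
    \<open>k = 1\<close> contribute to the entry of the square.\<close>
  have even: "A $$ (0, k) * A $$ (k, 1) = 0" if "k < n" "k \<notin> {0, 1}" for k
  proof -
    have "2 * A $$ (0, k) = 0" using par[of 2 "k + 1"] that n by simp
    moreover have "2 * A $$ (k, 1) = 0" using par[of "k + 1" 2] that n by simp
    ultimately show ?thesis
      by (cases "A $$ (0, k)" rule: mod4_cases; cases "A $$ (k, 1)" rule: mod4_cases) auto
  qed
  have "(A * A) $$ (0, 1) = (\<Sum>k<n. A $$ (0, k) * A $$ (k, 1))"
    using A n by (simp add: scalar_prod_def lessThan_atLeast0)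
  also have "\<dots> = (\<Sum>k\<in>{0, 1}. A $$ (0, k) * A $$ (k, 1))"
    using n even by (intro sum.mono_neutral_right) auto
  also have "\<dots> = A $$ (0, 1) * (A $$ (1, 1) + A $$ (0, 0))"
    by (simp add: algebra_simps)
  also have "\<dots> = 2" using odd by (simp only: diag mult.commute)
  finally show False using sq n by simp
qed

section \<open>The extension\<close>

lemma level4_normal: "level4_braid_group n \<lhd> braid_group n"
  unfolding level4_braid_group_def by (rule group_hom.normal_kernel[OF burau_mod4_group_hom])

lemma level4_iff:
  "x \<in> level4_braid_group n \<longleftrightarrow> x \<in> carrier (braid_group n) \<and> burau_mod4 n x = 1\<^sub>m n"
  by (simp add: level4_braid_group_def kernel_def general_linear_one)

text \<open>The parity condition for the identity matrix forces the identity permutation. Hence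
  \<open>braid_perm\<close> is constant on cosets, which makes \<open>Z_perm\<close> well
  defined.\<close>

lemma braid_perm_level4:
  assumes "x \<in> level4_braid_group n"
  shows "braid_perm n x = id"
proof -
  interpret group_hom "braid_group n" "sym_group n" "braid_perm n" by (rule braid_perm_group_hom)
  from assms have x: "x \<in> carrier (braid_group n)" "burau_mod4 n x = 1\<^sub>m n"
    by (auto simp: level4_iff)
  then show ?thesis
    using inversion_compatible_braid[OF x(1)] hom_closed[OF x(1)]
    by (auto simp: sym_group_carrier intro: inversion_compatible_one_imp_id)
qed

section \<open>The quotient group and its map to the symmetric group\<close>

lemma Z_group_carrier:
  "carrier (Z_group n) =
    (\<lambda>x. level4_braid_group n #>\<^bsub>braid_group n\<^esub> x) ` carrier (braid_group n)"
  by (simp add: Z_group_def carrier_FactGroup)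

lemma Z_group_mult:
  assumes "x \<in> carrier (braid_group n)" "y \<in> carrier (braid_group n)"
  shows "(level4_braid_group n #>\<^bsub>braid_group n\<^esub> x) \<otimes>\<^bsub>Z_group n\<^esub>
      (level4_braid_group n #>\<^bsub>braid_group n\<^esub> y) =
    level4_braid_group n #>\<^bsub>braid_group n\<^esub> (x \<otimes>\<^bsub>braid_group n\<^esub> y)"
  using assms by (simp add: Z_group_def normal.rcos_sum[OF level4_normal])

lemma Z_group_group: "group (Z_group n)"
  unfolding Z_group_def by (rule normal.factorgroup_is_group[OF level4_normal])

lemma Z_perm_coset:
  assumes "x \<in> carrier (braid_group n)"
  shows "Z_perm n (level4_braid_group n #>\<^bsub>braid_group n\<^esub> x) = braid_perm n x"
proof -
  interpret group_hom "braid_group n" "sym_group n" "braid_perm n" by (rule braid_perm_group_hom)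
  interpret N: normal "level4_braid_group n" "braid_group n" by (rule level4_normal)
  have "braid_perm n (l \<otimes>\<^bsub>braid_group n\<^esub> x) = braid_perm n x" if "l \<in> level4_braid_group n" for l
    using that assms by (simp add: braid_perm_level4 sym_group_mult)
  \<comment> \<open>The singleton image is what gives \<open>the_elem\<close> in
    \<open>Z_perm\<close> its value.\<close>
  then have "braid_perm n ` (level4_braid_group n #>\<^bsub>braid_group n\<^esub> x) = {braid_perm n x}"
    using group.rcos_self[OF braid_group_group assms N.subgroup_axioms] by (auto simp: r_coset_def)
  then show ?thesis by (simp add: Z_perm_def)
qed

lemma Z_perm_epi: "Z_perm n \<in> epi (Z_group n) (sym_group n)"
proof -
  interpret group_hom "braid_group n" "sym_group n" "braid_perm n" by (rule braid_perm_group_hom)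
  have "Z_perm n \<in> hom (Z_group n) (sym_group n)"
    by (rule homI) (auto simp: Z_group_carrier Z_group_mult Z_perm_coset simp del: hom_closed
      intro: hom_closed)
  moreover have "Z_perm n ` carrier (Z_group n) = carrier (sym_group n)"
    by (simp add: Z_group_carrier image_image Z_perm_coset braid_perm_surj)
  ultimately show ?thesis by (simp add: epi_def)
qed

lemma Z_perm_kernel: "kernel (Z_group n) (sym_group n) (Z_perm n) = carrier (PZ_group n)"
  by (auto simp: kernel_def PZ_group_def pure_braid_group_def Z_group_carrier Z_perm_coset)

lemma PZ_group_extension:
  "group_extension (PZ_group n) (Z_group n) (sym_group n) (\<lambda>x. x) (Z_perm n)"
proof -
  interpret group_hom "Z_group n" "sym_group n" "Z_perm n"
    using Z_perm_epi by (intro group_hom.intro group_hom_axioms.intro Z_group_group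
      sym_group_is_group) (simp add: epi_def)
  \<comment> \<open>Seen as a kernel, the carrier is a subgroup without further computation.\<close>
  have PZ: "PZ_group n = (Z_group n)\<lparr>carrier := kernel (Z_group n) (sym_group n) (Z_perm n)\<rparr>"
    by (simp add: Z_perm_kernel) (simp add: PZ_group_def)
  have "group (PZ_group n)"
    unfolding PZ by (rule subgroup.subgroup_is_group[OF subgroup_kernel Z_group_group])
  moreover have "(\<lambda>x. x) \<in> mon (PZ_group n) (Z_group n)"
    by (auto simp: PZ mon_def hom_def kernel_def)
  ultimately show ?thesis
    by (simp add: group_extension_def Z_group_group sym_group_is_group Z_perm_epi Z_perm_kernel)
qed

theorem proposition7p6:
  fixes n :: nat
  assumes "n \<ge> 2"
  shows "group_extension (PZ_group n) (Z_group n) (sym_group n) (\<lambda>x. x) (Z_perm n)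
    \<and> \<not> extension_splits (Z_group n) (sym_group n) (Z_perm n)"
proof (rule conjI[OF PZ_group_extension notI])
  interpret B: group_hom "braid_group n" "general_linear TYPE(4) n" "burau_mod4 n"
    by (rule burau_mod4_group_hom)
  interpret N: normal "level4_braid_group n" "braid_group n" by (rule level4_normal)
  \<comment> \<open>An involution of the symmetric group, available because
    \<open>n \<ge> 2\<close>.\<close>
  let ?\<tau> = "transpose 1 2 :: nat \<Rightarrow> nat"
  assume "extension_splits (Z_group n) (sym_group n) (Z_perm n)"
  then obtain s where s: "s \<in> hom (sym_group n) (Z_group n)"
    and sec: "\<And>q. q \<in> carrier (sym_group n) \<Longrightarrow> Z_perm n (s q) = q"
    by (auto simp: extension_splits_def)
  have \<tau>: "?\<tau> \<in> carrier (sym_group n)"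
    using assms by (simp add: sym_group_carrier permutes_swap_id)
  obtain x where x: "x \<in> carrier (braid_group n)"
    and sx: "s ?\<tau> = level4_braid_group n #>\<^bsub>braid_group n\<^esub> x"
    using hom_in_carrier[OF s \<tau>] by (auto simp: Z_group_carrier)
  have perm: "braid_perm n x = ?\<tau>"
    using sec[OF \<tau>] unfolding sx Z_perm_coset[OF x] .
  \<comment> \<open>The section preserves the relation that \<tau> squares to the identity, so the
    representative \<open>x\<close> squares into the level four subgroup.\<close>
  have "s ?\<tau> \<otimes>\<^bsub>Z_group n\<^esub> s ?\<tau> = s (?\<tau> \<otimes>\<^bsub>sym_group n\<^esub> ?\<tau>)"
    using hom_mult[OF s \<tau> \<tau>] by simp
  also have "\<dots> = \<one>\<^bsub>Z_group n\<^esub>"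
    using hom_one[OF s sym_group_is_group Z_group_group]
    by (simp add: sym_group_mult sym_group_one)
  finally have "level4_braid_group n #>\<^bsub>braid_group n\<^esub> (x \<otimes>\<^bsub>braid_group n\<^esub> x) = level4_braid_group n"
    unfolding sx Z_group_mult[OF x x] by (simp add: Z_group_def)
  then have "x \<otimes>\<^bsub>braid_group n\<^esub> x \<in> level4_braid_group n"
    using x B.G.coset_join1[OF _ _ N.subgroup_axioms] N.subset by blast
  then have "burau_mod4 n x * burau_mod4 n x = 1\<^sub>m n"
    using x by (simp add: level4_iff general_linear_mult)
  moreover have "burau_mod4 n x \<in> carrier_mat n n"
    using B.hom_closed[OF x] by (simp add: general_linear_carrier)
  ultimately show False
    using inversion_compatible_transpose_square[OF assms] inversion_compatible_braid[OF x]
    by (simp add: perm)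
qed

end
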